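(* Assume that the sequences $(d'_i)_{i\in\mathbf Z}$, $(d_i)_{i\in\mathbf Z}$ and $(f'_s(i,0))_{i\in\mathbf Z}$ are almost periodic with respect to $i$. Then $\underline{\omega}=\overline{\omega}$.
   Context: A sequence $(e_i)_{i\in\mathbf Z}$ is almost periodic if for every sequence of integers $(i_n)_{n\ge1}$ there is a subsequence $(i_{n_k})$ such that $e_{i+i_{n_k}}$ converges uniformly in $i\in\mathbf Z$ as $k\to\infty$. Standing assumptions. $(d_i)_{i\in\mathbf Z}$, $(d'_i)_{i\in\mathbf Z}$ are real sequences with $0<\inf_i d_i\le\sup_i d_i<\infty$ and $0<\inf_i d'_i\le\sup_i d'_i<\infty$. The function $f:\mathbf Z\times[0,1]\to\mathbf R$ satisfies: $f(i,0)=f(i,1)=0$ for all $i$; $0<\inf_j f(j,s)\le f(i,s)\le f'_s(i,0)s$ for all $i\in\mathbf Z$ and $s\in(0,1)$; for some Hölder exponent $\gamma\in(0,1]$, $\sup_i\|f(i,\cdot)\|_{C^{1+\gamma}([0,1])}<\infty$; and $\liminf_{|i|\to\infty}\big(f'_s(i,0)-(\sqrt{d'_i}-\sqrt{d_i})^2\big)>0$. Here $f'_s(i,0)$ is the derivative of $s\mapsto f(i,s)$ at $s=0$. Operators. For $n\in\mathbf Z$ let $X_n$ be the set of functions $[n,+\infty)\cap\mathbf Z\to\mathbf R$; $X_{-\infty}$ is the set of functions $\mathbf Z\to\mathbf R$. Let $(\mathcal L\phi)_i=d'_i(\phi_{i+1}-\phi_i)+d_i(\phi_{i-1}-\phi_i)+f'_s(i,0)\phi_i$,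 mapping $X_n$ to $X_{n+1}$ (and $X_{-\infty}$ to itself), and for $p\in\mathbf R$, $(L_p\phi)_i=e^{-pi}(\mathcal L(e^{p\cdot}\phi))_i$, where $(e^{p\cdot}\phi)_j=e^{pj}\phi_j$. Generalized principal eigenvalues. For $n\in\{-\infty\}\cup\mathbf Z$ let $I_n=(n,+\infty)\cap\mathbf Z$. For $n\in\mathbf Z$, $\mathcal A_n$ is the set of $\phi\in X_n$ with $\phi_i>0$ for $i\ge n$, $\lim_{i\to+\infty}\frac{\ln\phi_i}{i}=0$, and both sequences $\big(\frac{\phi_{i+1}-\phi_i}{\phi_i}\big)_{i\ge n}$, $\big(\frac{\phi_{i+1}-\phi_i}{\phi_{i+1}}\big)_{i\ge n}$ bounded. $\mathcal A_{-\infty}$ is the set of $\phi\in X_{-\infty}$ with $\phi_i>0$ for all $i$, $\lim_{|i|\to\infty}\frac{\ln\phi_i}{i}=0$, and $\big(\frac{\phi_{i\pm1}-\phi_i}{\phi_i}\big)_{i\in\mathbf Z}$ bounded. Define $$\underline{\lambda_1}(p,n)=\sup\{\lambda:\exists\phi\in\mathcal A_n,\ (L_p\phi)_i\ge\lambda\phi_i\ \forall i\in I_n\},\quad \overline{\lambda_1}(p,n)=\inf\{\lambda:\exists\phi\in\mathcal A_n,\ (L_p\phi)_i\le\lambda\phi_i\ \forall i\in I_n\}.$$ $\underline{\lambda_1}(p,n)$ is nondecreasing and $\overline{\lambda_1}(p,n)$ nonincreasing in $n$. Speeds. $\underline H(p)=\lim_{n\to+\infty}\underline{\lambda_1}(p,n)$,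 $\overline H(p)=\lim_{n\to+\infty}\overline{\lambda_1}(p,n)$, and $\underline{\omega}=\min_{p>0}\frac{\underline H(-p)}{p}$, $\overline{\omega}=\min_{p>0}\frac{\overline H(-p)}{p}$. *)

theory Defs
  imports "HOL-Analysis.Analysis"
begin

definition almost_periodic :: "(int \<Rightarrow> real) \<Rightarrow> bool" where
  "almost_periodic e \<longleftrightarrow>
     (\<forall>\<iota> :: nat \<Rightarrow> int. \<exists>r :: nat \<Rightarrow> nat. strict_mono r \<and>
        uniformly_convergent_on UNIV (\<lambda>k i. e (i + \<iota> (r k))))"

text \<open>Functions on \<open>[0,1]\<close> are represented by functions on the whole line whose values outside
  \<open>[0,1]\<close> are irrelevant; derivatives are therefore taken within \<open>[0,1]\<close>, so that they
  are one-sided at the end points.\<close>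

definition deriv01 :: "(real \<Rightarrow> real) \<Rightarrow> real \<Rightarrow> real" where
  "deriv01 g s = vector_derivative g (at s within {0..1})"

text \<open>The norm of \<open>C\<^sup>1\<^sup>+\<^sup>\<gamma>([0,1])\<close>, infinite when one of the three suprema is. It is
  meaningful only for \<open>g\<close> differentiable on \<open>[0,1]\<close>; then finiteness of the last term
  makes the derivative continuous.\<close>

definition C1_holder_norm :: "real \<Rightarrow> (real \<Rightarrow> real) \<Rightarrow> ereal" where
  "C1_holder_norm \<gamma> g =
     (SUP s\<in>{0..1}. ereal \<bar>g s\<bar>) + (SUP s\<in>{0..1}. ereal \<bar>deriv01 g s\<bar>) +
     (SUP (s, t)\<in>{(s, t). s \<in> {0..1} \<and> t \<in> {0..1} \<and> s \<noteq> t}.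
        ereal (\<bar>deriv01 g s - deriv01 g t\<bar> / \<bar>s - t\<bar> powr \<gamma>))"

definition growth_rate :: "(int \<Rightarrow> real \<Rightarrow> real) \<Rightarrow> int \<Rightarrow> real" where
  "growth_rate f i = deriv01 (f i) 0"

text \<open>Below, \<open>r\<close> stands for the sequence \<open>growth_rate f\<close>.\<close>

definition lin_op ::
  "(int \<Rightarrow> real) \<Rightarrow> (int \<Rightarrow> real) \<Rightarrow> (int \<Rightarrow> real) \<Rightarrow> (int \<Rightarrow> real) \<Rightarrow> int \<Rightarrow> real" where
  "lin_op d d' r \<phi> i = d' i * (\<phi> (i + 1) - \<phi> i) + d i * (\<phi> (i - 1) - \<phi> i) + r i * \<phi> i"

definition lin_op_exp ::
  "(int \<Rightarrow> real) \<Rightarrow> (int \<Rightarrow> real) \<Rightarrow> (int \<Rightarrow> real) \<Rightarrow> real \<Rightarrow> (int \<Rightarrow> real) \<Rightarrow> int \<Rightarrow> real" where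
  "lin_op_exp d d' r p \<phi> i =
     exp (- p * of_int i) * lin_op d d' r (\<lambda>j. exp (p * of_int j) * \<phi> j) i"

text \<open>An element of \<open>X\<^sub>n\<close> is represented by a function on all integers; only its values at
  \<open>i \<ge> n\<close> enter in what follows.\<close>

definition admissible :: "int \<Rightarrow> (int \<Rightarrow> real) set" where
  "admissible n = {\<phi>.
     (\<forall>i\<ge>n. \<phi> i > 0) \<and>
     ((\<lambda>i. ln (\<phi> i) / of_int i) \<longlongrightarrow> 0) at_top \<and>
     bounded ((\<lambda>i. (\<phi> (i + 1) - \<phi> i) / \<phi> i) ` {n..}) \<and>
     bounded ((\<lambda>i. (\<phi> (i + 1) - \<phi> i) / \<phi> (i + 1)) ` {n..})}"

text \<open>Suprema, infima and limits are taken in the extended reals, where they always exist (the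
  limits by monotonicity in \<open>n\<close>).\<close>

definition lambda_lower ::
  "(int \<Rightarrow> real) \<Rightarrow> (int \<Rightarrow> real) \<Rightarrow> (int \<Rightarrow> real) \<Rightarrow> real \<Rightarrow> int \<Rightarrow> ereal" where
  "lambda_lower d d' r p n =
     Sup {ereal c | c. \<exists>\<phi>\<in>admissible n. \<forall>i>n. lin_op_exp d d' r p \<phi> i \<ge> c * \<phi> i}"

definition lambda_upper ::
  "(int \<Rightarrow> real) \<Rightarrow> (int \<Rightarrow> real) \<Rightarrow> (int \<Rightarrow> real) \<Rightarrow> real \<Rightarrow> int \<Rightarrow> ereal" where
  "lambda_upper d d' r p n =
     Inf {ereal c | c. \<exists>\<phi>\<in>admissible n. \<forall>i>n. lin_op_exp d d' r p \<phi> i \<le> c * \<phi> i}"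

definition H_lower ::
  "(int \<Rightarrow> real) \<Rightarrow> (int \<Rightarrow> real) \<Rightarrow> (int \<Rightarrow> real) \<Rightarrow> real \<Rightarrow> ereal" where
  "H_lower d d' r p = Lim at_top (\<lambda>n. lambda_lower d d' r p n)"

definition H_upper ::
  "(int \<Rightarrow> real) \<Rightarrow> (int \<Rightarrow> real) \<Rightarrow> (int \<Rightarrow> real) \<Rightarrow> real \<Rightarrow> ereal" where
  "H_upper d d' r p = Lim at_top (\<lambda>n. lambda_upper d d' r p n)"

definition speeds_lower ::
  "(int \<Rightarrow> real) \<Rightarrow> (int \<Rightarrow> real) \<Rightarrow> (int \<Rightarrow> real) \<Rightarrow> ereal set" where
  "speeds_lower d d' r = {H_lower d d' r (- p) / ereal p | p. p > 0}"

definition speeds_upper ::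
  "(int \<Rightarrow> real) \<Rightarrow> (int \<Rightarrow> real) \<Rightarrow> (int \<Rightarrow> real) \<Rightarrow> ereal set" where
  "speeds_upper d d' r = {H_upper d d' r (- p) / ereal p | p. p > 0}"

text \<open>The speeds are minima of these sets. They are defined as infima; to say that the infimum is
  a minimum is to say that it belongs to the set.\<close>

definition omega_lower ::
  "(int \<Rightarrow> real) \<Rightarrow> (int \<Rightarrow> real) \<Rightarrow> (int \<Rightarrow> real) \<Rightarrow> ereal" where
  "omega_lower d d' r = Inf (speeds_lower d d' r)"

definition omega_upper ::
  "(int \<Rightarrow> real) \<Rightarrow> (int \<Rightarrow> real) \<Rightarrow> (int \<Rightarrow> real) \<Rightarrow> ereal" where
  "omega_upper d d' r = Inf (speeds_upper d d' r)"

end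

theory Submission
  imports Defs "HOL-Real_Asymp.Real_Asymp"
begin

text \<open>For each \<open>p\<close> the lower and upper eigenvalues coincide and do not depend on \<open>n\<close>. Writing
  \<open>\<phi> = exp w\<close>, the discounted equation \<open>exp (- w) L\<^sub>p (exp w) = \<epsilon> w\<close> has a bounded solution whose
  increments are bounded uniformly in \<open>\<epsilon>\<close>. Comparison of \<open>w\<close> with its translates, together with
  the total boundedness of the translates of the coefficients, shows that \<open>\<epsilon> w\<close> is almost constant
  for small \<open>\<epsilon>\<close>, so \<open>exp w\<close> is an approximate eigenfunction, admissible for both eigenvalues. The
  common value \<open>h p\<close> is continuous in \<open>p\<close>, grows exponentially, and is bounded below by a positive
  constant because of the assumption on the limit inferior, tested with \<open>\<phi> = 1\<close>; hence
  \<open>h (- p) / p\<close> attains its minimum.\<close>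

section \<open>Almost periodic sequences: compactness of translates\<close>

text \<open>Subsequences are extracted for one member of \<open>A\<close> after the other; a further
  subsequence keeps the uniform convergence already obtained.\<close>

lemma almost_periodic_common_subseq:
  assumes "finite A" "\<forall>e\<in>A. almost_periodic e"
  shows "\<exists>r :: nat \<Rightarrow> nat. strict_mono r \<and>
    (\<forall>e\<in>A. uniformly_convergent_on UNIV (\<lambda>k i. e (i + \<iota> (r k))))"
  using assms
proof (induction A)
  case empty
  show ?case by (auto intro: exI[of _ "\<lambda>x. x"] simp: strict_mono_def)
next
  case (insert e A)
  then obtain r :: "nat \<Rightarrow> nat" where r: "strict_mono r"
    "\<forall>e\<in>A. uniformly_convergent_on UNIV (\<lambda>k i. e (i + \<iota> (r k)))"
    by auto
  from insert.prems have "almost_periodic e" by simp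
  then obtain r' :: "nat \<Rightarrow> nat" where r': "strict_mono r'"
    "uniformly_convergent_on UNIV (\<lambda>k i. e (i + (\<iota> \<circ> r) (r' k)))"
    unfolding almost_periodic_def by blast
  have "uniformly_convergent_on UNIV (\<lambda>k i. g (i + \<iota> ((r \<circ> r') k)))" if "g \<in> A" for g
  proof -
    from r(2) that obtain l where
      "uniform_limit UNIV (\<lambda>k i. g (i + \<iota> (r k))) l sequentially"
      unfolding uniformly_convergent_on_def by blast
    then have "uniform_limit UNIV (\<lambda>k i. g (i + \<iota> (r (r' k)))) l sequentially"
      using filterlim_compose[OF _ filterlim_subseq[OF r'(1)]] by blast
    then show ?thesis unfolding uniformly_convergent_on_def by auto
  qed
  with r'(2) show ?case
    using strict_mono_o[OF r(1) r'(1)] by (intro exI[of _ "r \<circ> r'"]) (auto simp: strict_mono_def)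
qed

text \<open>Failure would give, by dependent choice, a sequence of shifts that are pairwise not
  \<open>close\<close>; along no subsequence of it could the translates of all members of
  \<open>A\<close> be uniformly Cauchy.\<close>

lemma almost_periodic_translates_totally_bounded:
  assumes A: "finite A" "\<forall>e\<in>A. almost_periodic e" and "\<eta> > 0"
  shows "\<exists>T. finite T \<and> (\<forall>a. \<exists>s\<in>T. \<forall>e\<in>A. \<forall>i. \<bar>e (i + a) - e (i + s)\<bar> \<le> \<eta>)"
proof (rule ccontr)
  define close where "close = (\<lambda>a s. \<forall>e\<in>A. \<forall>i. \<bar>e (i + a) - e (i + s)\<bar> \<le> \<eta>)"
  assume "\<not> ?thesis"
  then have far: "\<exists>a. \<forall>s\<in>T. \<not> close a s" if "finite T" for T
    using that unfolding close_def by meson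
  have "\<exists>\<iota> :: nat \<Rightarrow> int. \<forall>k. \<forall>j<k. \<not> close (\<iota> k) (\<iota> j)"
  proof (rule dependent_wellorder_choice)
    show "\<exists>a. \<forall>j<k. \<not> close a (\<iota> j)" for k :: nat and \<iota> :: "nat \<Rightarrow> int"
      using far[of "\<iota> ` {..<k}"] by auto
  qed auto
  then obtain \<iota> :: "nat \<Rightarrow> int" where \<iota>: "\<And>j k. j < k \<Longrightarrow> \<not> close (\<iota> k) (\<iota> j)"
    by blast
  obtain r :: "nat \<Rightarrow> nat" where r: "strict_mono r"
    "\<forall>e\<in>A. uniformly_convergent_on UNIV (\<lambda>k i. e (i + \<iota> (r k)))"
    using almost_periodic_common_subseq[OF A] by blast
  have "\<forall>\<^sub>F k in sequentially. \<forall>m\<ge>k. \<forall>i. dist (e (i + \<iota> (r m))) (e (i + \<iota> (r k))) < \<eta>"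
    if "e \<in> A" for e
  proof -
    have "uniformly_Cauchy_on UNIV (\<lambda>k i. e (i + \<iota> (r k)))"
      using r(2) that uniformly_convergent_eq_Cauchy
      by (metis uniformly_convergent_Cauchy)
    then obtain M where "\<forall>x\<in>UNIV. \<forall>m\<ge>M. \<forall>n\<ge>M. dist (e (x + \<iota> (r m))) (e (x + \<iota> (r n))) < \<eta>"
      using \<open>\<eta> > 0\<close> unfolding uniformly_Cauchy_on_def by blast
    then show ?thesis
      by (intro eventually_sequentiallyI[of M]) auto
  qed
  then have "\<forall>\<^sub>F k in sequentially. \<forall>e\<in>A. \<forall>m\<ge>k. \<forall>i. dist (e (i + \<iota> (r m))) (e (i + \<iota> (r k))) < \<eta>"
    using A(1) by (simp add: eventually_ball_finite)
  then obtain k where k: "\<forall>e\<in>A. \<forall>m\<ge>k. \<forall>i. dist (e (i + \<iota> (r m))) (e (i + \<iota> (r k))) < \<eta>"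
    unfolding eventually_sequentially by blast
  have "close (\<iota> (r (Suc k))) (\<iota> (r k))"
    unfolding close_def using k by (fastforce simp: dist_real_def intro: less_imp_le)
  moreover have "r k < r (Suc k)" using r(1) by (simp add: strict_mono_def)
  ultimately show False using \<iota> by blast
qed

text \<open>Compared at the origin, each value \<open>e a\<close> lies within \<open>1\<close> of
  one of the finitely many \<open>e s\<close> with \<open>s\<close> in \<open>T\<close>.\<close>

lemma almost_periodic_bounded:
  assumes "almost_periodic e"
  obtains B where "\<And>i. \<bar>e i\<bar> \<le> B"
proof -
  obtain T where T: "finite T" "\<forall>a. \<exists>s\<in>T. \<forall>i. \<bar>e (i + a) - e (i + s)\<bar> \<le> 1"
    using almost_periodic_translates_totally_bounded[of "{e}" 1] assms by auto
  have "\<bar>e a\<bar> \<le> 1 + (\<Sum>s\<in>T. \<bar>e s\<bar>)" for a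
  proof -
    from T(2) obtain s where s: "s \<in> T" "\<bar>e (0 + a) - e (0 + s)\<bar> \<le> 1" by blast
    have "\<bar>e s\<bar> \<le> (\<Sum>s\<in>T. \<bar>e s\<bar>)" using s(1) T(1) by (intro member_le_sum) auto
    with s(2) show ?thesis by simp
  qed
  then show thesis using that by blast
qed

section \<open>Admissible functions and comparison of eigenvalue constants\<close>

text \<open>Iterating the step keeps \<open>u\<close> above a line of slope \<open>s\<close>, so
  \<open>u i / i\<close> cannot have a limit below \<open>s\<close>. Applied to logarithms, this
  excludes exponential growth.\<close>

lemma sublinear_no_linear_growth:
  fixes u :: "int \<Rightarrow> real"
  assumes lim: "((\<lambda>i. u i / of_int i) \<longlongrightarrow> 0) at_top"
    and "s > 0" and step: "\<And>i. i \<ge> m \<Longrightarrow> u (i + 1) \<ge> u i + s"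
  shows False
proof -
  have lin: "u (m + int k) \<ge> u m + real k * s" for k
  proof (induction k)
    case (Suc k)
    then show ?case using step[of "m + int k"] by (simp add: algebra_simps)
  qed simp
  have top: "filterlim (\<lambda>k. m + int k) at_top sequentially"
    unfolding filterlim_at_top
  proof
    fix Z show "\<forall>\<^sub>F k in sequentially. Z \<le> m + int k"
      using eventually_ge_at_top[of "nat (Z - m)"] by eventually_elim linarith
  qed
  have 1: "(\<lambda>k. u (m + int k) / of_int (m + int k)) \<longlonglongrightarrow> 0"
    using filterlim_compose[OF lim top] by simp
  have 2: "(\<lambda>k. (u m + real k * s) / (of_int m + real k)) \<longlonglongrightarrow> s"
    by real_asymp
  have "\<forall>\<^sub>F k in sequentially. (u m + real k * s) / (of_int m + real k)
      \<le> u (m + int k) / of_int (m + int k)"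
    using eventually_ge_at_top[of "nat \<bar>m\<bar> + 1"]
  proof eventually_elim
    case (elim k)
    then have "(of_int m :: real) + real k > 0" by linarith
    then show ?case using lin[of k] by (simp add: divide_right_mono)
  qed
  from tendsto_le[OF _ 1 2 this] \<open>s > 0\<close> show False by simp
qed

text \<open>The two boundedness conditions amount to a Harnack inequality between neighbours, with
  one constant for both directions.\<close>

lemma admissible_ratio_bounds:
  assumes "\<phi> \<in> admissible n"
  obtains B where "\<And>i. i \<ge> n \<Longrightarrow> \<phi> (i + 1) \<le> B * \<phi> i" "\<And>i. i \<ge> n \<Longrightarrow> \<phi> i \<le> B * \<phi> (i + 1)"
proof -
  from assms have pos: "\<And>i. i \<ge> n \<Longrightarrow> \<phi> i > 0"
    and b: "bounded ((\<lambda>i. (\<phi> (i + 1) - \<phi> i) / \<phi> i) ` {n..})"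
      "bounded ((\<lambda>i. (\<phi> (i + 1) - \<phi> i) / \<phi> (i + 1)) ` {n..})"
    by (auto simp: admissible_def)
  obtain B1 where B1: "\<And>i. i \<ge> n \<Longrightarrow> \<bar>(\<phi> (i + 1) - \<phi> i) / \<phi> i\<bar> \<le> B1"
    using b(1) unfolding bounded_real by auto
  obtain B2 where B2: "\<And>i. i \<ge> n \<Longrightarrow> \<bar>(\<phi> (i + 1) - \<phi> i) / \<phi> (i + 1)\<bar> \<le> B2"
    using b(2) unfolding bounded_real by auto
  show thesis
  proof (rule that[of "1 + max B1 B2"])
    fix i assume i: "i \<ge> n"
    have p: "\<phi> i > 0" "\<phi> (i + 1) > 0" using pos i by auto
    have "(\<phi> (i + 1) - \<phi> i) / \<phi> i \<le> max B1 B2" using B1[OF i] by linarith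
    with p show "\<phi> (i + 1) \<le> (1 + max B1 B2) * \<phi> i" by (simp add: field_simps)
    have "- (max B1 B2) \<le> (\<phi> (i + 1) - \<phi> i) / \<phi> (i + 1)" using B2[OF i] by linarith
    with p show "\<phi> i \<le> (1 + max B1 B2) * \<phi> (i + 1)" by (simp add: field_simps)
  qed
qed

lemma lin_op_exp_eq:
  "lin_op_exp d d' r p \<phi> i =
    d' i * exp p * \<phi> (i + 1) + d i * exp (- p) * \<phi> (i - 1) + (r i - d i - d' i) * \<phi> i"
proof -
  have [simp]: "exp (- (p * of_int i)) * (exp (p * of_int i) * x) = x"
    "exp (p * of_int i) * (exp (- (p * of_int i)) * x) = x" for x :: real
    by (simp_all add: exp_minus field_simps)
  show ?thesis
    by (simp add: lin_op_exp_def lin_op_def algebra_simps exp_add exp_diff)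
      (simp add: exp_minus field_simps)
qed

text \<open>A bounded logarithm divided by \<open>i\<close> tends to \<open>0\<close>, and the
  neighbour ratios stay below \<open>exp (2 * N)\<close>. All test functions constructed below have
  this form.\<close>

lemma admissible_exp_bounded:
  assumes "\<And>i. \<bar>w i\<bar> \<le> N"
  shows "(\<lambda>i. exp (w i)) \<in> admissible n"
proof -
  have "((\<lambda>i. w i * (1 / of_int i)) \<longlongrightarrow> 0) at_top"
  proof (rule Lim_null_comparison)
    show "\<forall>\<^sub>F i in at_top. norm (w i * (1 / of_int i)) \<le> N * \<bar>1 / of_int i\<bar>"
      using assms by (intro always_eventually) (auto simp: abs_mult intro!: divide_right_mono)
    have "filterlim (real_of_int) at_top at_top" by (rule filterlim_real_of_int_at_top)
    then show "((\<lambda>i::int. N * \<bar>1 / real_of_int i\<bar>) \<longlongrightarrow> 0) at_top"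
      by (intro tendsto_mult_right_zero tendsto_rabs_zero tendsto_divide_0[OF tendsto_const])
        (rule filterlim_at_top_imp_at_infinity)
  qed
  moreover have "\<bar>(exp (w (i + 1)) - exp (w i)) / exp (w i)\<bar> \<le> 1 + exp (2 * N)"
    "\<bar>(exp (w (i + 1)) - exp (w i)) / exp (w (i + 1))\<bar> \<le> 1 + exp (2 * N)" for i
  proof -
    have d: "exp (w i - w (i+1)) \<le> exp (2 * N)" "exp (w (i+1) - w i) \<le> exp (2 * N)"
      using assms[of i] assms[of "i + 1"] by auto
    have "(exp (w (i + 1)) - exp (w i)) / exp (w i) = exp (w (i+1) - w i) - 1"
      "(exp (w (i + 1)) - exp (w i)) / exp (w (i + 1)) = 1 - exp (w i - w (i+1))"
      by (simp_all add: exp_diff field_simps)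
    with d show "\<bar>(exp (w (i + 1)) - exp (w i)) / exp (w i)\<bar> \<le> 1 + exp (2 * N)"
      "\<bar>(exp (w (i + 1)) - exp (w i)) / exp (w (i + 1))\<bar> \<le> 1 + exp (2 * N)"
      using exp_gt_zero[of "w (i+1) - w i"] exp_gt_zero[of "w i - w (i+1)"] by linarith+
  qed
  ultimately show ?thesis
    unfolding admissible_def bounded_real by (auto simp: image_iff)
qed

text \<open>The ratio \<open>\<phi> / \<psi>\<close> would otherwise grow or decay exponentially.\<close>

lemma subsolution_constant_le_supersolution_constant:
  assumes D: "\<And>i. 0 < d i" "\<And>i. d i \<le> b" "\<And>i. 0 < d' i" "\<And>i. d' i \<le> b"
    and \<phi>: "\<phi> \<in> admissible n" "\<And>i. i > n \<Longrightarrow> lin_op_exp d d' r p \<phi> i \<ge> c * \<phi> i"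
    and \<psi>: "\<psi> \<in> admissible n" "\<And>i. i > n \<Longrightarrow> lin_op_exp d d' r p \<psi> i \<le> c' * \<psi> i"
  shows "c \<le> c'"
proof (rule ccontr)
  assume "\<not> c \<le> c'"
  define \<delta> where "\<delta> = c - c'"
  have "\<delta> > 0" using \<open>\<not> c \<le> c'\<close> by (simp add: \<delta>_def)
  have p\<phi>: "\<And>i. i \<ge> n \<Longrightarrow> \<phi> i > 0" and p\<psi>: "\<And>i. i \<ge> n \<Longrightarrow> \<psi> i > 0"
    using \<phi>(1) \<psi>(1) by (auto simp: admissible_def)
  obtain B where B: "\<And>i. i \<ge> n \<Longrightarrow> \<psi> (i + 1) \<le> B * \<psi> i" "\<And>i. i \<ge> n \<Longrightarrow> \<psi> i \<le> B * \<psi> (i + 1)"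
    using admissible_ratio_bounds[OF \<psi>(1)] by blast
  have "B > 0" using B(1)[of n] p\<psi>[of n] p\<psi>[of "n + 1"] by (smt (verit) mult_nonpos_nonneg)
  have "b > 0" using D(1)[of 0] D(2)[of 0] by linarith
  define A where "A = b * (exp p + exp (- p)) * B"
  have "A > 0" using \<open>B > 0\<close> \<open>b > 0\<close> by (simp add: A_def add_pos_pos)
  \<comment> \<open>Dividing \<phi> by the supersolution \<psi> eliminates the diagonal coefficient:
    the ratio \<open>z\<close> satisfies \<open>ineq\<close>, whose weights \<open>P\<close> and
    \<open>Q\<close> are positive and at most \<open>A * \<psi> i\<close>.\<close>
  define P where "P i = d' i * exp p * \<psi> (i + 1)" for i
  define Q where "Q i = d i * exp (- p) * \<psi> (i - 1)" for i
  define z where "z i = \<phi> i / \<psi> i" for i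
  have pz: "z i > 0" if "i \<ge> n" for i using that p\<phi> p\<psi> by (simp add: z_def)
  have \<phi>z: "\<phi> i = z i * \<psi> i" if "i \<ge> n" for i using p\<psi>[OF that] by (simp add: z_def)
  have P: "0 < P i" "P i \<le> A * \<psi> i" if "i > n" for i
  proof -
    show "0 < P i" using D p\<psi>[of "i + 1"] that by (simp add: P_def)
    have "P i \<le> b * (exp p + exp (- p)) * (B * \<psi> i)"
      unfolding P_def using D[of i] \<open>b > 0\<close> B(1)[of i] p\<psi>[of "i + 1"] that
      by (intro mult_mono) (auto simp: add_nonneg_nonneg)
    then show "P i \<le> A * \<psi> i" by (simp add: A_def mult.assoc)
  qed
  have Q: "0 < Q i" "Q i \<le> A * \<psi> i" if "i > n" for i
  proof -
    show "0 < Q i" using D p\<psi>[of "i - 1"] that by (simp add: Q_def)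
    have "Q i \<le> b * (exp p + exp (- p)) * (B * \<psi> i)"
      unfolding Q_def using D[of i] \<open>b > 0\<close> B(2)[of "i - 1"] p\<psi>[of "i - 1"] that
      by (intro mult_mono) (auto simp: add_nonneg_nonneg)
    then show "Q i \<le> A * \<psi> i" by (simp add: A_def mult.assoc)
  qed
  have ineq: "P i * (z (i + 1) - z i) + Q i * (z (i - 1) - z i) \<ge> \<delta> * \<psi> i * z i" if "i > n" for i
  proof -
    have "P i + Q i + (r i - d i - d' i) * \<psi> i \<le> c' * \<psi> i"
      using \<psi>(2)[OF that] by (simp add: lin_op_exp_eq P_def Q_def)
    then have "z i * (P i + Q i + (r i - d i - d' i) * \<psi> i) \<le> z i * (c' * \<psi> i)"
      using pz[of i] that by (intro mult_left_mono) auto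
    moreover have "P i * z (i + 1) + Q i * z (i - 1) + (r i - d i - d' i) * (z i * \<psi> i) \<ge> c * (z i * \<psi> i)"
      using \<phi>(2)[OF that] that by (simp add: lin_op_exp_eq P_def Q_def \<phi>z mult_ac)
    ultimately show ?thesis by (simp add: \<delta>_def algebra_simps)
  qed
  \<comment> \<open>If the left neighbour contributes nothing positive, the right one must supply
    the whole gain \<open>\<delta> * \<psi> i * z i\<close> with a weight of at most
    \<open>A * \<psi> i\<close>, which forces growth by a fixed factor. \<open>down\<close> is the
    mirror image.\<close>
  have up: "z (i + 1) \<ge> (1 + \<delta> / A) * z i" if "i > n" "z i \<ge> z (i - 1)" for i
  proof -
    have "Q i * (z (i - 1) - z i) \<le> 0" using Q(1)[of i] that by (simp add: mult_nonneg_nonpos)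
    then have *: "P i * (z (i + 1) - z i) \<ge> \<delta> * \<psi> i * z i" using ineq[OF that(1)] by linarith
    moreover have "\<delta> * \<psi> i * z i > 0" using \<open>\<delta> > 0\<close> p\<psi>[of i] pz[of i] that by simp
    ultimately have "z (i + 1) - z i \<ge> 0" using P(1)[of i] that
      by (smt (verit) mult_nonneg_nonpos)
    then have "P i * (z (i + 1) - z i) \<le> A * \<psi> i * (z (i + 1) - z i)"
      using P(2)[of i] that by (intro mult_right_mono) auto
    with * have "\<psi> i * (\<delta> * z i) \<le> \<psi> i * (A * (z (i + 1) - z i))" by (simp add: mult_ac)
    then have "\<delta> * z i \<le> A * (z (i + 1) - z i)" using p\<psi>[of i] that by simp
    then show ?thesis using \<open>A > 0\<close> by (simp add: field_simps)
  qed
  have down: "z (i - 1) \<ge> (1 + \<delta> / A) * z i" if "i > n" "z (i + 1) \<le> z i" for i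
  proof -
    have "P i * (z (i + 1) - z i) \<le> 0" using P(1)[of i] that by (simp add: mult_nonneg_nonpos)
    then have *: "Q i * (z (i - 1) - z i) \<ge> \<delta> * \<psi> i * z i" using ineq[OF that(1)] by linarith
    moreover have "\<delta> * \<psi> i * z i > 0" using \<open>\<delta> > 0\<close> p\<psi>[of i] pz[of i] that by simp
    ultimately have "z (i - 1) - z i \<ge> 0" using Q(1)[of i] that
      by (smt (verit) mult_nonneg_nonpos)
    then have "Q i * (z (i - 1) - z i) \<le> A * \<psi> i * (z (i - 1) - z i)"
      using Q(2)[of i] that by (intro mult_right_mono) auto
    with * have "\<psi> i * (\<delta> * z i) \<le> \<psi> i * (A * (z (i - 1) - z i))" by (simp add: mult_ac)
    then have "\<delta> * z i \<le> A * (z (i - 1) - z i)" using p\<psi>[of i] that by simp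
    then show ?thesis using \<open>A > 0\<close> by (simp add: field_simps)
  qed
  define s where "s = ln (1 + \<delta> / A)"
  have "1 + \<delta> / A > 1" using \<open>\<delta> > 0\<close> \<open>A > 0\<close> by simp
  then have "s > 0" by (simp add: s_def)
  have lns: "ln x + s \<le> ln y" if "(1 + \<delta> / A) * x \<le> y" "x > 0" for x y
  proof -
    have "ln x + s = ln ((1 + \<delta> / A) * x)"
      using that \<open>1 + \<delta> / A > 1\<close> by (simp add: s_def ln_mult)
    also have "\<dots> \<le> ln y"
      using that(1) mult_pos_pos[OF _ that(2), of "1 + \<delta> / A"] \<open>1 + \<delta> / A > 1\<close>
      by (intro ln_mono) linarith+
    finally show ?thesis .
  qed
  have lim: "((\<lambda>i. ln (z i) / of_int i) \<longlongrightarrow> 0) at_top"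
  proof -
    have "((\<lambda>i. ln (\<phi> i) / of_int i - ln (\<psi> i) / of_int i) \<longlongrightarrow> 0 - 0) at_top"
      using \<phi>(1) \<psi>(1) by (intro tendsto_diff) (auto simp: admissible_def)
    moreover have "\<forall>\<^sub>F i in at_top. ln (\<phi> i) / of_int i - ln (\<psi> i) / of_int i = ln (z i) / of_int i"
      using eventually_ge_at_top[of n]
    proof eventually_elim
      case (elim i)
      then show ?case
        using p\<phi>[of i] p\<psi>[of i] by (simp add: z_def ln_div diff_divide_distrib)
    qed
    ultimately show ?thesis by (simp add: Lim_transform_eventually)
  qed
  show False
  \<comment> \<open>Once \<open>z\<close> fails to decrease at one site, \<open>up\<close>
    propagates growth to all later sites; otherwise \<open>z\<close> decreases from \<open>n\<close>
    on and \<open>down\<close> makes the decay geometric. Either contradicts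
    \<open>lim\<close>.\<close>
  proof (cases "\<exists>j\<ge>n. z (j + 1) \<ge> z j")
    case True
    then obtain j where j: "j \<ge> n" "z (j + 1) \<ge> z j" by blast
    have inc: "z (i + 1) \<ge> z i" if "i \<ge> j" for i
      using that
    proof (induction i rule: int_ge_induct)
      case (step i)
      have "(1 + \<delta> / A) * z (i + 1) \<ge> 1 * z (i + 1)"
        using \<open>1 + \<delta> / A > 1\<close> pz[of "i + 1"] step j(1) by (intro mult_right_mono) auto
      then show ?case using up[of "i + 1"] step j(1) by simp
    qed (use j in auto)
    show False
    proof (rule sublinear_no_linear_growth[OF lim \<open>s > 0\<close>])
      \<comment> \<open>\<open>up\<close> at \<open>i\<close> looks back at \<open>i - 1\<close>, so
        the growth is counted from one site after \<open>j\<close>; this also gives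
        \<open>i > n\<close>.\<close>
      fix i assume "i \<ge> j + 1"
      then show "ln (z i) + s \<le> ln (z (i + 1))"
        using inc[of "i - 1"] up[of i] pz[of i] j(1) by (intro lns) auto
    qed
  next
    case False
    then have dec: "z (j + 1) \<le> z j" if "j \<ge> n" for j using that by fastforce
    show False
    proof (rule sublinear_no_linear_growth[of "\<lambda>i. - ln (z i)", OF _ \<open>s > 0\<close>])
      show "((\<lambda>i. - ln (z i) / real_of_int i) \<longlongrightarrow> 0) at_top"
        using tendsto_minus[OF lim] by simp
      fix i assume "i \<ge> n"
      then have "ln (z (i + 1)) + s \<le> ln (z i)"
        using dec[of "i + 1"] down[of "i + 1"] pz[of "i + 1"] by (intro lns) auto
      then show "- ln (z i) + s \<le> - ln (z (i + 1))" by simp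
    qed
  qed
qed

section \<open>The discounted equation for the logarithm\<close>

text \<open>The neighbour part of the conjugated operator applied to \<open>exp w\<close> and
  divided by \<open>exp w\<close>: a discrete Hamiltonian. The diagonal part does not depend on
  \<open>w\<close> and is kept apart.\<close>

definition hop :: "(int \<Rightarrow> real) \<Rightarrow> (int \<Rightarrow> real) \<Rightarrow> real \<Rightarrow> (int \<Rightarrow> real) \<Rightarrow> int \<Rightarrow> real" where
  "hop d d' p w i = d' i * exp (p + w (i + 1) - w i) + d i * exp (- p + w (i - 1) - w i)"

lemma lin_op_exp_exp:
  "lin_op_exp d d' r p (\<lambda>j. exp (w j)) i = (hop d d' p w i + (r i - d i - d' i)) * exp (w i)"
proof -
  have "exp (p + w (i + 1) - w i) * exp (w i) = exp p * exp (w (i + 1))"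
    "exp (- p + w (i - 1) - w i) * exp (w i) = exp (- p) * exp (w (i - 1))"
    by (simp_all flip: exp_add)
  then show ?thesis
    unfolding lin_op_exp_eq hop_def ring_distribs mult.assoc by simp
qed

text \<open>The slack \<eta> comes out of both exponentials as a factor. It permits comparison at a
  site where \<open>w - v\<close> only nearly attains its supremum.\<close>

lemma hop_mono:
  assumes "0 \<le> d i" "0 \<le> d' i" "w (i + 1) - w i \<le> v (i + 1) - v i + \<eta>" "w (i - 1) - w i \<le> v (i - 1) - v i + \<eta>"
  shows "hop d d' p w i \<le> exp \<eta> * hop d d' p v i"
proof -
  have "exp (p + w (i + 1) - w i) \<le> exp (\<eta> + (p + v (i + 1) - v i))"
    "exp (- p + w (i - 1) - w i) \<le> exp (\<eta> + (- p + v (i - 1) - v i))"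
    using assms by auto
  then have "hop d d' p w i \<le> d' i * exp (\<eta> + (p + v (i + 1) - v i)) + d i * exp (\<eta> + (- p + v (i - 1) - v i))"
    unfolding hop_def using assms by (intro add_mono mult_left_mono)
  also have "\<dots> = exp \<eta> * hop d d' p v i"
    by (simp only: hop_def exp_add[of \<eta>] ring_distribs mult_ac)
  finally show ?thesis .
qed

text \<open>At a site where \<open>w - v\<close> is within \<eta> of its supremum \<open>m\<close>,
  the increments of \<open>w\<close> exceed those of \<open>v\<close> by at most \<eta>. Subtracting
  the two inequalities there bounds \<open>\<epsilon> * m\<close> by \<kappa> up to an error that
  vanishes with \<eta>. The defect \<kappa> admits translated solutions as approximate
  supersolutions.\<close>

lemma discounted_comparison:
  assumes nonneg: "\<And>i. 0 \<le> d i" "\<And>i. 0 \<le> d' i" and "\<epsilon> > 0"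
    and bd: "\<And>i. \<bar>w i\<bar> \<le> N" "\<And>i. \<bar>v i\<bar> \<le> N" "\<And>i. \<bar>V i\<bar> \<le> B"
    and sub: "\<And>i. \<epsilon> * w i \<le> hop d d' p w i + V i"
    and super: "\<And>i. hop d d' p v i + V i \<le> \<epsilon> * v i + \<kappa>"
  shows "\<epsilon> * w i \<le> \<epsilon> * v i + \<kappa>"
proof -
  define m where "m = (SUP i. w i - v i)"
  have bdd: "bdd_above (range (\<lambda>i. w i - v i))"
  proof (rule bdd_aboveI)
    fix x assume "x \<in> range (\<lambda>i. w i - v i)"
    then obtain j where "x = w j - v j" by blast
    then show "x \<le> 2 * N" using bd(1)[of j] bd(2)[of j] by linarith
  qed
  have le_m: "w i - v i \<le> m" for i
    unfolding m_def by (rule cSUP_upper[OF _ bdd]) simp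
  \<comment> \<open>By the supersolution inequality, \<open>C\<close> bounds \<open>hop\<close> of
    \<open>v\<close> at every site, independently of \<eta>.\<close>
  define C where "C = \<epsilon> * N + \<bar>\<kappa>\<bar> + B"
  have est: "\<epsilon> * m - \<kappa> \<le> \<epsilon> * \<eta> + (exp \<eta> - 1) * C" if \<eta>: "\<eta> > 0" for \<eta>
  proof -
    obtain j where j: "m - \<eta> < w j - v j"
      using \<eta> less_cSUP_iff[OF _ bdd, of "m - \<eta>"] unfolding m_def by auto
    have le: "hop d d' p w j \<le> exp \<eta> * hop d d' p v j"
      by (rule hop_mono) (use nonneg j le_m[of "j + 1"] le_m[of "j - 1"] in auto)
    have "\<epsilon> * v j \<le> \<epsilon> * N" using bd(2)[of j] \<open>\<epsilon> > 0\<close> by (intro mult_left_mono) auto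
    then have "hop d d' p v j \<le> C" unfolding C_def using super[of j] bd(3)[of j] by linarith
    then have "(exp \<eta> - 1) * hop d d' p v j \<le> (exp \<eta> - 1) * C"
      using that by (intro mult_left_mono) auto
    with le have "hop d d' p w j \<le> hop d d' p v j + (exp \<eta> - 1) * C"
      by (simp add: algebra_simps)
    with sub[of j] super[of j] have "\<epsilon> * (w j - v j) \<le> \<kappa> + (exp \<eta> - 1) * C"
      by (simp add: algebra_simps)
    moreover have "\<epsilon> * (m - \<eta>) \<le> \<epsilon> * (w j - v j)" using j \<open>\<epsilon> > 0\<close> by (intro mult_left_mono) auto
    ultimately show ?thesis by (simp add: algebra_simps)
  qed
  have lim: "((\<lambda>\<eta>. \<epsilon> * \<eta> + (exp \<eta> - 1) * C) \<longlongrightarrow> 0) (at_right 0)"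
    by (auto intro!: tendsto_eq_intros)
  have "\<epsilon> * m - \<kappa> \<le> 0"
  proof (rule tendsto_lowerbound[OF lim])
    show "\<forall>\<^sub>F \<eta> in at_right 0. \<epsilon> * m - \<kappa> \<le> \<epsilon> * \<eta> + (exp \<eta> - 1) * C"
      using est by (auto simp: eventually_at_right_less intro: eventually_at_rightI[of 0 1])
  qed simp
  moreover have "\<epsilon> * (w i - v i) \<le> \<epsilon> * m" using le_m[of i] \<open>\<epsilon> > 0\<close> by (intro mult_left_mono) auto
  ultimately show ?thesis by (simp add: algebra_simps)
qed

text \<open>Perron's method: the supremum of all bounded subsolutions is a solution.\<close>

lemma discounted_solution:
  assumes nonneg: "\<And>i. 0 \<le> d i" "\<And>i. 0 \<le> d' i" and "\<epsilon> > 0"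
    and N: "\<And>i. d' i * exp p + d i * exp (- p) + \<bar>V i\<bar> \<le> \<epsilon> * N"
  obtains w where "\<And>i. hop d d' p w i + V i = \<epsilon> * w i" "\<And>i. \<bar>w i\<bar> \<le> N"
proof -
  \<comment> \<open>The hypothesis on \<open>N\<close> puts the constant \<open>- N\<close> into
    \<open>S\<close>; it also forbids a strict inequality at a site where the supremum
    \<open>W\<close> equals \<open>N\<close>.\<close>
  define S where "S = {w. (\<forall>i. \<bar>w i\<bar> \<le> N) \<and> (\<forall>i. \<epsilon> * w i \<le> hop d d' p w i + V i)}"
  define W where "W i = (SUP w\<in>S. w i)" for i
  have hop0: "0 \<le> hop d d' p w i" for w i using nonneg by (simp add: hop_def)
  have "0 \<le> \<epsilon> * N" using N[of 0] nonneg[of 0]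
    by (smt (verit) exp_ge_zero mult_nonneg_nonneg)
  then have "0 \<le> N" using \<open>\<epsilon> > 0\<close> by (simp add: zero_le_mult_iff)
  have "\<bar>V i\<bar> \<le> \<epsilon> * N" for i using N[of i] nonneg[of i]
    by (smt (verit) exp_ge_zero mult_nonneg_nonneg)
  then have "- (\<epsilon> * N) \<le> hop d d' p w i + V i" for w i
    using hop0[of w i] by (smt (verit))
  then have S0: "(\<lambda>_. - N) \<in> S" using \<open>0 \<le> N\<close> unfolding S_def by simp
  have bdd: "bdd_above ((\<lambda>w. w i) ` S)" for i
    by (rule bdd_aboveI[of _ N]) (auto simp: S_def abs_le_iff)
  have leW: "w i \<le> W i" if "w \<in> S" for w i
    unfolding W_def by (rule cSUP_upper[OF that bdd])
  have W_le: "W i \<le> N" for i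
    unfolding W_def
  proof (rule cSUP_least)
    show "S \<noteq> {}" using S0 by blast
  qed (auto simp: S_def abs_le_iff)
  have WN: "\<bar>W i\<bar> \<le> N" for i using leW[OF S0, of i] W_le[of i] by simp
  \<comment> \<open>The residual of the equation at \<open>i\<close> when the neighbours are frozen
    at \<open>W\<close> and the value at \<open>i\<close> is \<open>x\<close>.\<close>
  define g where
    "g i x = d' i * exp (p + W (i + 1) - x) + d i * exp (- p + W (i - 1) - x) + V i - \<epsilon> * x" for i x
  have cont: "continuous_on UNIV (g i)" for i unfolding g_def by (intro continuous_intros)
  have gW: "g i (W i) = hop d d' p W i + V i - \<epsilon> * W i" for i by (simp add: g_def hop_def)
  have ge: "0 \<le> g i (W i)" for i
  proof -
    \<comment> \<open>Raising the neighbours of a subsolution \<open>w\<close> to \<open>W\<close>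
      does not lower \<open>hop\<close>, so each \<open>w i\<close> has nonnegative residual; this
      closed condition passes to the supremum.\<close>
    have "closed {x. 0 \<le> g i x}" using cont by (intro closed_Collect_le) auto
    moreover have "(\<lambda>w. w i) ` S \<subseteq> {x. 0 \<le> g i x}"
    proof clarify
      fix w assume w: "w \<in> S"
      have "hop d d' p w i \<le> d' i * exp (p + W (i + 1) - w i) + d i * exp (- p + W (i - 1) - w i)"
        unfolding hop_def using nonneg leW[OF w, of "i + 1"] leW[OF w, of "i - 1"]
        by (intro add_mono mult_left_mono) auto
      moreover have "\<epsilon> * w i \<le> hop d d' p w i + V i" using w by (simp add: S_def)
      ultimately show "0 \<le> g i (w i)" unfolding g_def by linarith
    qed
    ultimately have "W i \<in> {x. 0 \<le> g i x}"
      unfolding W_def using S0 bdd by (metis closed_subset_contains_Sup empty_iff image_is_empty)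
    then show ?thesis by simp
  qed
  \<comment> \<open>Were the residual positive, \<open>W\<close> could be raised slightly at the
    single site \<open>i\<close>: the inequality at \<open>i\<close> survives by continuity and
    those elsewhere do not get worse, against maximality.\<close>
  have le: "g i (W i) \<le> 0" for i
  proof (rule ccontr)
    assume pos: "\<not> g i (W i) \<le> 0"
    have "W i \<noteq> N"
    proof
      assume eq: "W i = N"
      have "hop d d' p W i \<le> d' i * exp p + d i * exp (- p)"
        unfolding hop_def using nonneg W_le[of "i + 1"] W_le[of "i - 1"] eq
        by (intro add_mono mult_left_mono) auto
      moreover have "\<epsilon> * W i = \<epsilon> * N" using eq by simp
      ultimately have "g i (W i) \<le> 0" unfolding gW using N[of i] by linarith
      with pos show False by simp
    qed
    then have "W i < N" using W_le[of i] by simp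
    have "\<forall>\<^sub>F x in at_right (W i). 0 < g i x"
    proof (rule order_tendstoD(1))
      show "(g i \<longlongrightarrow> g i (W i)) (at_right (W i))"
        using cont[of i] by (meson UNIV_I continuous_on_def tendsto_within_subset top_greatest)
    qed (use pos in simp)
    moreover have "\<forall>\<^sub>F x in at_right (W i). x \<in> {W i<..<N}"
      using \<open>W i < N\<close> by (rule eventually_at_right_real)
    ultimately have "\<forall>\<^sub>F x in at_right (W i). 0 < g i x \<and> x \<in> {W i<..<N}"
      by (rule eventually_conj)
    then obtain x where x: "0 < g i x" "W i < x" "x < N"
      using eventually_happens[of _ "at_right (W i)"] by force
    have "W(i := x) \<in> S"
      unfolding S_def
    proof (intro CollectI conjI allI)
      fix j show "\<bar>(W(i := x)) j\<bar> \<le> N" using WN[of i] WN[of j] x by auto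
      show "\<epsilon> * (W(i := x)) j \<le> hop d d' p (W(i := x)) j + V j"
      proof (cases "j = i")
        case True
        then show ?thesis using x(1) by (simp add: g_def hop_def)
      next
        case False
        have "hop d d' p W j \<le> hop d d' p (W(i := x)) j"
          unfolding hop_def using nonneg x(2) False by (intro add_mono mult_left_mono) auto
        then show ?thesis using False ge[of j] gW[of j] by simp
      qed
    qed
    from leW[OF this, of i] x(2) show False by simp
  qed
  show thesis
    by (rule that[of W]) (use gW ge le WN in \<open>auto intro: antisym simp: algebra_simps\<close>, smt (verit))
qed

section \<open>Approximate correctors for almost periodic coefficients\<close>

locale almost_periodic_coefficients =
  fixes d d' r :: "int \<Rightarrow> real" and a b :: real
  assumes a_pos: "0 < a"
    and d_bounds: "\<And>i. a \<le> d i" "\<And>i. d i \<le> b"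
    and d'_bounds: "\<And>i. a \<le> d' i" "\<And>i. d' i \<le> b"
    and r_bound: "\<And>i. \<bar>r i\<bar> \<le> b"
    and ap: "almost_periodic d" "almost_periodic d'" "almost_periodic r"
begin

definition V :: "int \<Rightarrow> real" where
  "V i = r i - d i - d' i"

lemma b_pos: "0 < b"
  using a_pos d_bounds[of 0] by linarith

lemma d_nonneg: "0 \<le> d i" "0 \<le> d' i"
  using a_pos d_bounds[of i] d'_bounds[of i] by linarith+

lemma V_bound: "\<bar>V i\<bar> \<le> 3 * b"
  using a_pos d_bounds[of i] d'_bounds[of i] r_bound[of i] unfolding V_def by linarith

text \<open>The translate of \<open>w\<close> solves the equation with translated coefficients. In
  the original one it is a supersolution up to a defect: \<open>\<eta> * Q\<close> from each
  neighbour term and \<open>3 * \<eta>\<close> from the three summands of \<open>V\<close>.\<close>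

lemma discounted_translate:
  assumes "\<epsilon> > 0" and eq: "\<And>i. hop d d' p w i + V i = \<epsilon> * w i" and bd: "\<And>i. \<bar>w i\<bar> \<le> N"
    and Q: "\<And>i. exp (p + w (i + 1) - w i) \<le> Q" "\<And>i. exp (- p + w (i - 1) - w i) \<le> Q"
    and \<tau>: "\<And>i. \<bar>d (i + \<tau>) - d i\<bar> \<le> \<eta>" "\<And>i. \<bar>d' (i + \<tau>) - d' i\<bar> \<le> \<eta>" "\<And>i. \<bar>r (i + \<tau>) - r i\<bar> \<le> \<eta>"
  shows "\<epsilon> * w i \<le> \<epsilon> * w (i + \<tau>) + \<eta> * (2 * Q + 3)"
proof (rule discounted_comparison[where v = "\<lambda>i. w (i + \<tau>)" and w = w and V = V and d = d and d' = d' and p = p])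
  fix i
  let ?x = "exp (p + w (i + \<tau> + 1) - w (i + \<tau>))" and ?y = "exp (- p + w (i + \<tau> - 1) - w (i + \<tau>))"
  have "0 \<le> \<eta>" using \<tau>(1)[of 0] by linarith
  have prod: "t * e \<le> \<eta> * Q" if "t \<le> \<eta>" "0 \<le> e" "e \<le> Q" for t e
    using mult_right_mono[OF that(1,2)] mult_left_mono[OF that(3) \<open>0 \<le> \<eta>\<close>] by linarith
  have "(d' i - d' (i + \<tau>)) * ?x \<le> \<eta> * Q" "(d i - d (i + \<tau>)) * ?y \<le> \<eta> * Q"
    by (rule prod; use \<tau>(1,2)[of i] Q[of "i + \<tau>"] in \<open>simp add: abs_le_iff\<close>)+
  then have "hop d d' p (\<lambda>i. w (i + \<tau>)) i \<le> hop d d' p w (i + \<tau>) + 2 * (\<eta> * Q)"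
    by (simp add: hop_def algebra_simps)
  moreover have "V i \<le> V (i + \<tau>) + 3 * \<eta>"
    using \<tau>[of i] unfolding V_def by linarith
  ultimately show "hop d d' p (\<lambda>i. w (i + \<tau>)) i + V i \<le> \<epsilon> * w (i + \<tau>) + \<eta> * (2 * Q + 3)"
    using eq[of "i + \<tau>"] by (simp add: algebra_simps)
qed (use d_nonneg assms V_bound in auto)

text \<open>Vanishing discount: the solutions \<open>w\<close> of the discounted equations are Lipschitz uniformly
  in \<open>\<epsilon>\<close>, and almost periodicity turns this into \<open>osc (\<epsilon> w) \<rightarrow> 0\<close>.\<close>

lemma approximate_corrector:
  assumes "\<delta> > 0"
  shows "\<exists>c w N. (\<forall>i. \<bar>w i\<bar> \<le> N) \<and> (\<forall>i. \<bar>hop d d' p w i + V i - c\<bar> \<le> \<delta>)"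
proof -
  have cancel: "x / (4 * y) * y = x / 4" if "y > 0" for x y :: real using that by simp
  \<comment> \<open>\<open>M\<close> bounds \<open>\<epsilon> * w\<close>. Then \<open>hop\<close>
    is at most \<open>M + 3 * b\<close>, and since the coefficients are at least \<open>a\<close>,
    \<open>Q\<close> bounds both exponentials in it; \<open>K\<close> is the resulting Lipschitz
    constant of \<open>w\<close>. None of them depends on \<epsilon>.\<close>
  define M where "M = b * (exp p + exp (- p)) + 3 * b"
  define Q where "Q = (M + 3 * b) / a"
  define K where "K = \<bar>ln Q\<bar> + \<bar>p\<bar>"
  have "M > 0" using b_pos by (simp add: M_def add_pos_pos)
  have "Q > 0" using b_pos a_pos \<open>M > 0\<close> by (simp add: Q_def)
  \<comment> \<open>Makes the defect in \<open>discounted_translate\<close> equal to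
    \<open>\<delta> / 4\<close>.\<close>
  define \<eta> where "\<eta> = \<delta> / (4 * (2 * Q + 3))"
  have "\<eta> > 0" using \<open>Q > 0\<close> \<open>\<delta> > 0\<close> by (simp add: \<eta>_def)
  have \<eta>: "\<eta> * (2 * Q + 3) = \<delta> / 4"
    unfolding \<eta>_def by (rule cancel) (use \<open>Q > 0\<close> in simp)
  obtain T where T: "finite T" "\<And>i. \<exists>s\<in>T. \<forall>e\<in>{d, d', r}. \<forall>j. \<bar>e (j + i) - e (j + s)\<bar> \<le> \<eta>"
    using almost_periodic_translates_totally_bounded[of "{d, d', r}", OF _ _ \<open>\<eta> > 0\<close>] ap by auto
  define R where "R = (\<Sum>s\<in>T. \<bar>real_of_int s\<bar>)"
  have R: "\<bar>real_of_int s\<bar> \<le> R" if "s \<in> T" for s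
    unfolding R_def using that T(1) by (intro member_le_sum) auto
  have "R \<ge> 0" unfolding R_def by (intro sum_nonneg) auto
  \<comment> \<open>Chosen after \<open>T\<close>, so that \<open>\<epsilon> * w\<close> varies by
    at most \<open>\<delta> / 2\<close> over \<open>T\<close>, any two of whose points are at
    distance at most \<open>2 * R\<close>. The \<open>1\<close> keeps the denominator
    positive.\<close>
  define \<epsilon> where "\<epsilon> = \<delta> / (4 * (K * R + 1))"
  have "K \<ge> 0" by (simp add: K_def)
  have "0 < K * R + 1" using \<open>K \<ge> 0\<close> \<open>R \<ge> 0\<close> by (simp add: add_nonneg_pos)
  then have "\<epsilon> > 0" using \<open>\<delta> > 0\<close> by (simp add: \<epsilon>_def)
  have "\<epsilon> * (K * R + 1) = \<delta> / 4"
    unfolding \<epsilon>_def using \<open>0 < K * R + 1\<close> by (rule cancel)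
  then have \<epsilon>: "\<epsilon> * (K * R) \<le> \<delta> / 4" using \<open>\<epsilon> > 0\<close> by (simp add: algebra_simps)
  have "d' i * exp p + d i * exp (- p) + \<bar>V i\<bar> \<le> \<epsilon> * (M / \<epsilon>)" for i
  proof -
    have "d' i * exp p + d i * exp (- p) \<le> b * exp p + b * exp (- p)"
      using d_bounds d'_bounds by (intro add_mono mult_right_mono) auto
    also have "\<dots> = M - 3 * b" by (simp add: M_def algebra_simps)
    finally show ?thesis using V_bound[of i] \<open>\<epsilon> > 0\<close> by simp
  qed
  from discounted_solution[of d d' \<epsilon> p V, OF d_nonneg \<open>\<epsilon> > 0\<close> this] obtain w
    where w: "\<And>i. hop d d' p w i + V i = \<epsilon> * w i" "\<And>i. \<bar>w i\<bar> \<le> M / \<epsilon>" by blast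
  have wQ: "exp (p + w (i + 1) - w i) \<le> Q" "exp (- p + w (i - 1) - w i) \<le> Q" for i
  proof -
    have "\<epsilon> * w i \<le> \<epsilon> * (M / \<epsilon>)" using w(2)[of i] \<open>\<epsilon> > 0\<close> by (intro mult_left_mono) auto
    then have hop: "hop d d' p w i \<le> M + 3 * b"
      using w(1)[of i] V_bound[of i] \<open>\<epsilon> > 0\<close> by simp
    have "a * exp (p + w (i + 1) - w i) \<le> d' i * exp (p + w (i + 1) - w i)"
      "a * exp (- p + w (i - 1) - w i) \<le> d i * exp (- p + w (i - 1) - w i)"
      using d_bounds d'_bounds by (auto intro: mult_right_mono)
    moreover have "0 \<le> d' i * exp (p + w (i + 1) - w i)" "0 \<le> d i * exp (- p + w (i - 1) - w i)"
      using d_nonneg by auto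
    ultimately have "a * exp (p + w (i + 1) - w i) \<le> M + 3 * b" "a * exp (- p + w (i - 1) - w i) \<le> M + 3 * b"
      using hop unfolding hop_def by linarith+
    then show "exp (p + w (i + 1) - w i) \<le> Q" "exp (- p + w (i - 1) - w i) \<le> Q"
      using a_pos by (simp_all add: Q_def field_simps)
  qed
  \<comment> \<open>The two upper bounds in \<open>wQ\<close>, the second one taken at
    \<open>i + 1\<close>, bound the same increment from above and from below.\<close>
  have step: "\<bar>w (i + 1) - w i\<bar> \<le> K" for i
  proof -
    have "p + w (i + 1) - w i \<le> ln Q" "- p + w (i + 1 - 1) - w (i + 1) \<le> ln Q"
      using wQ(1)[of i] wQ(2)[of "i + 1"] \<open>Q > 0\<close> by (simp_all add: ln_ge_iff)
    then show ?thesis unfolding K_def by simp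
  qed
  have lip: "\<bar>w (i + int k) - w i\<bar> \<le> K * real k" for i k
  proof (induction k)
    case (Suc k)
    then show ?case using step[of "i + int k"] by (simp add: algebra_simps)
  qed simp
  have lip': "\<bar>w i - w j\<bar> \<le> K * \<bar>real_of_int (i - j)\<bar>" for i j
  proof (cases "i \<ge> j")
    case True
    then show ?thesis using lip[of j "nat (i - j)"] by simp
  next
    case False
    then show ?thesis using lip[of i "nat (j - i)"] by (simp add: abs_minus_commute)
  qed
  \<comment> \<open>Some \<open>s\<close> in \<open>T\<close> sees almost the same coefficients as
    \<open>i\<close>; the translations by \<open>s - i\<close> and \<open>i - s\<close> give the two
    inequalities, however far \<open>i\<close> is from \<open>s\<close>.\<close>
  have near: "\<exists>s\<in>T. \<bar>\<epsilon> * w i - \<epsilon> * w s\<bar> \<le> \<delta> / 4" for i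
  proof -
    obtain s where s: "s \<in> T" "\<forall>e\<in>{d, d', r}. \<forall>j. \<bar>e (j + i) - e (j + s)\<bar> \<le> \<eta>"
      using T(2) by blast
    have "\<bar>e (j + (s - i)) - e j\<bar> \<le> \<eta>" "\<bar>e (j + (i - s)) - e j\<bar> \<le> \<eta>" if "e \<in> {d, d', r}" for e j
      using s(2)[rule_format, OF that, of "j - i"] s(2)[rule_format, OF that, of "j - s"]
      by (simp_all add: algebra_simps abs_minus_commute)
    then have "\<epsilon> * w i \<le> \<epsilon> * w (i + (s - i)) + \<eta> * (2 * Q + 3)"
      "\<epsilon> * w s \<le> \<epsilon> * w (s + (i - s)) + \<eta> * (2 * Q + 3)"
      by (intro discounted_translate[OF \<open>\<epsilon> > 0\<close> w(1) w(2) wQ]; blast)+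
    then have "\<epsilon> * w i \<le> \<epsilon> * w s + \<delta> / 4" "\<epsilon> * w s \<le> \<epsilon> * w i + \<delta> / 4"
      unfolding \<eta> by simp_all
    then have "\<bar>\<epsilon> * w i - \<epsilon> * w s\<bar> \<le> \<delta> / 4" by linarith
    with s(1) show ?thesis by blast
  qed
  have T_near: "\<bar>\<epsilon> * w s - \<epsilon> * w t\<bar> \<le> \<delta> / 2" if "s \<in> T" "t \<in> T" for s t
  proof -
    have "\<bar>w s - w t\<bar> \<le> K * (2 * R)"
      using R[OF that(1)] R[OF that(2)] \<open>K \<ge> 0\<close> by (intro order_trans[OF lip'] mult_left_mono) auto
    then have "\<epsilon> * \<bar>w s - w t\<bar> \<le> \<epsilon> * (K * (2 * R))" using \<open>\<epsilon> > 0\<close> by (intro mult_left_mono) auto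
    also have "\<dots> = 2 * (\<epsilon> * (K * R))" by simp
    also have "\<dots> \<le> \<delta> / 2" using \<epsilon> by linarith
    finally show ?thesis using \<open>\<epsilon> > 0\<close> by (simp add: abs_mult flip: right_diff_distrib)
  qed
  have "\<bar>\<epsilon> * w i - \<epsilon> * w 0\<bar> \<le> \<delta>" for i
  proof -
    obtain s t where st: "s \<in> T" "\<bar>\<epsilon> * w i - \<epsilon> * w s\<bar> \<le> \<delta> / 4"
      "t \<in> T" "\<bar>\<epsilon> * w 0 - \<epsilon> * w t\<bar> \<le> \<delta> / 4"
      using near[of i] near[of 0] by blast
    with T_near[OF st(1,3)] show ?thesis by linarith
  qed
  then have "\<forall>i. \<bar>hop d d' p w i + V i - \<epsilon> * w 0\<bar> \<le> \<delta>" using w(1) by simp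
  with w(2) show ?thesis by blast
qed

section \<open>Equality of the two eigenvalues\<close>

lemma sub_le_lambda_lower:
  assumes "\<And>i. \<bar>w i\<bar> \<le> N" "\<And>i. i > n \<Longrightarrow> c \<le> hop d d' p w i + V i"
  shows "ereal c \<le> lambda_lower d d' r p n"
proof -
  have "(\<lambda>i. exp (w i)) \<in> admissible n" using assms(1) by (rule admissible_exp_bounded)
  moreover have "\<forall>i>n. c * exp (w i) \<le> lin_op_exp d d' r p (\<lambda>i. exp (w i)) i"
  proof (intro allI impI)
    fix i assume "i > n"
    then show "c * exp (w i) \<le> lin_op_exp d d' r p (\<lambda>i. exp (w i)) i"
      unfolding lin_op_exp_exp using assms(2)[of i] by (intro mult_right_mono) (simp_all add: V_def)
  qed
  ultimately show ?thesis
    unfolding lambda_lower_def by (intro Sup_upper CollectI exI[of _ c] conjI[OF refl] bexI[of _ "\<lambda>i. exp (w i)"])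
qed

lemma lambda_upper_le_super:
  assumes "\<And>i. \<bar>w i\<bar> \<le> N" "\<And>i. i > n \<Longrightarrow> hop d d' p w i + V i \<le> c"
  shows "lambda_upper d d' r p n \<le> ereal c"
proof -
  have "(\<lambda>i. exp (w i)) \<in> admissible n" using assms(1) by (rule admissible_exp_bounded)
  moreover have "\<forall>i>n. lin_op_exp d d' r p (\<lambda>i. exp (w i)) i \<le> c * exp (w i)"
  proof (intro allI impI)
    fix i assume "i > n"
    then show "lin_op_exp d d' r p (\<lambda>i. exp (w i)) i \<le> c * exp (w i)"
      unfolding lin_op_exp_exp using assms(2)[of i] by (intro mult_right_mono) (simp_all add: V_def)
  qed
  ultimately show ?thesis
    unfolding lambda_upper_def by (intro Inf_lower CollectI exI[of _ c] conjI[OF refl] bexI[of _ "\<lambda>i. exp (w i)"])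
qed

lemma lambda_lower_le_upper: "lambda_lower d d' r p n \<le> lambda_upper d d' r p n"
proof -
  have pos: "0 < d i" "0 < d' i" for i using a_pos d_bounds[of i] d'_bounds[of i] by linarith+
  have "ereal c \<le> ereal c'"
    if "\<phi> \<in> admissible n" "\<forall>i>n. c * \<phi> i \<le> lin_op_exp d d' r p \<phi> i"
      "\<psi> \<in> admissible n" "\<forall>i>n. lin_op_exp d d' r p \<psi> i \<le> c' * \<psi> i" for c c' \<phi> \<psi>
    unfolding ereal_less_eq
    by (rule subsolution_constant_le_supersolution_constant[where \<phi> = \<phi> and \<psi> = \<psi> and d = d and d' = d'
          and b = b and p = p and r = r and n = n])
      (use that pos d_bounds(2) d'_bounds(2) in blast)+
  then show ?thesis
    unfolding lambda_lower_def lambda_upper_def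
    by (intro Sup_least Inf_greatest) (elim CollectE exE conjE bexE, simp only:)
qed

text \<open>An approximate corrector lives on all integers, so one constant \<open>c\<close>
  brackets the eigenvalues for every \<open>n\<close> at once. Since the lower one is at most the
  upper one, both are squeezed to a single number.\<close>

lemma lambda_eq_constant:
  "\<exists>h. \<forall>n. lambda_lower d d' r p n = ereal h \<and> lambda_upper d d' r p n = ereal h"
proof -
  have gap: "\<exists>c. \<forall>n. ereal (c - \<delta>) \<le> lambda_lower d d' r p n \<and> lambda_upper d d' r p n \<le> ereal (c + \<delta>)"
    if \<delta>: "\<delta> > 0" for \<delta>
  proof -
    obtain c w N where w: "\<And>i. \<bar>w i\<bar> \<le> N" "\<And>i. \<bar>hop d d' p w i + V i - c\<bar> \<le> \<delta>"
      using approximate_corrector[OF \<delta>] by blast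
    have lo: "c - \<delta> \<le> hop d d' p w i + V i" and hi: "hop d d' p w i + V i \<le> c + \<delta>" for i
      using w(2)[of i] by linarith+
    show ?thesis
      using sub_le_lambda_lower[OF w(1) lo] lambda_upper_le_super[OF w(1) hi] by blast
  qed
  \<comment> \<open>Error \<open>1\<close> already rules out infinite values, so the squeeze can be
    carried out in the reals.\<close>
  have fin: "\<bar>lambda_lower d d' r p n\<bar> \<noteq> \<infinity>" "\<bar>lambda_upper d d' r p n\<bar> \<noteq> \<infinity>" for n
  proof -
    obtain c where "ereal (c - 1) \<le> lambda_lower d d' r p n" "lambda_upper d d' r p n \<le> ereal (c + 1)"
      using gap[of 1] by auto
    then show "\<bar>lambda_lower d d' r p n\<bar> \<noteq> \<infinity>" "\<bar>lambda_upper d d' r p n\<bar> \<noteq> \<infinity>"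
      using lambda_lower_le_upper[of p n]
      by (cases "lambda_lower d d' r p n"; cases "lambda_upper d d' r p n"; simp)+
  qed
  define l u where "l n = real_of_ereal (lambda_lower d d' r p n)"
    and "u n = real_of_ereal (lambda_upper d d' r p n)" for n
  have l: "lambda_lower d d' r p n = ereal (l n)" and u: "lambda_upper d d' r p n = ereal (u n)" for n
    using fin by (simp_all add: l_def u_def ereal_real)
  have lu: "l n \<le> u n" for n using lambda_lower_le_upper[of p n] by (simp add: l u)
  \<comment> \<open>Two different indices are possible because \<open>c\<close> depends on neither;
    this yields independence of \<open>n\<close> together with equality.\<close>
  have "u n \<le> l m" for n m
  proof (rule field_le_epsilon)
    fix e :: real assume "e > 0"
    then obtain c where "c - e / 2 \<le> l m" "u n \<le> c + e / 2"
      using gap[of "e / 2"] by (auto simp: l u)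
    then show "u n \<le> l m + e" by simp
  qed
  then have "l n = l 0 \<and> u n = l 0" for n using lu by (meson order_antisym order_trans)
  then show ?thesis by (auto simp: l u)
qed

section \<open>Growth and continuity of the eigenvalue, and its minimal quotient\<close>

definition h :: "real \<Rightarrow> real" where
  "h p = real_of_ereal (lambda_lower d d' r p 0)"

lemma lambda_eq_h: "lambda_lower d d' r p n = ereal (h p)" "lambda_upper d d' r p n = ereal (h p)"
  using lambda_eq_constant[of p] by (auto simp: h_def)

lemma H_eq_h: "H_lower d d' r p = ereal (h p)" "H_upper d d' r p = ereal (h p)"
  unfolding H_lower_def H_upper_def lambda_eq_h by (simp_all add: tendsto_Lim)

text \<open>As the eigenvalue does not depend on \<open>n\<close>, a bounded test function need only
  satisfy the inequality beyond some site.\<close>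

lemma le_hI:
  assumes "\<And>i. \<bar>w i\<bar> \<le> N" "\<And>i. i > n \<Longrightarrow> c \<le> hop d d' p w i + V i"
  shows "c \<le> h p"
  using sub_le_lambda_lower[OF assms] by (simp add: lambda_eq_h)

text \<open>Test with the constant function and keep only the larger of the two neighbour terms;
  \<open>3 * b\<close> absorbs the diagonal.\<close>

lemma h_ge_exp: "a * exp \<bar>p\<bar> - 3 * b \<le> h p"
proof (rule le_hI[where w = "\<lambda>_. 0" and n = 0 and N = 0])
  fix i
  have "a * exp p \<le> d' i * exp p" "a * exp (- p) \<le> d i * exp (- p)"
    using d_bounds d'_bounds by (auto intro: mult_right_mono)
  moreover have "0 \<le> a * exp p" "0 \<le> a * exp (- p)" using a_pos by auto
  ultimately have "a * exp \<bar>p\<bar> \<le> d' i * exp p + d i * exp (- p)"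
    by (cases "0 \<le> p") linarith+
  then show "a * exp \<bar>p\<bar> - 3 * b \<le> hop d d' p (\<lambda>_. 0) i + V i"
    using V_bound[of i] by (simp add: hop_def)
qed simp

text \<open>Changing \<open>p\<close> multiplies the off-diagonal terms by at most \<open>exp \<bar>p - q\<bar>\<close>; the shift by \<open>3 b\<close>
  removes the diagonal ones.\<close>

lemma h_exp_lipschitz: "h p + 3 * b \<le> exp \<bar>p - q\<bar> * (h q + 3 * b)"
proof -
  \<comment> \<open>An approximate corrector for \<open>p\<close> serves as test function for
    \<open>q\<close>; \<delta> pays for its error.\<close>
  have "exp (- \<bar>p - q\<bar>) * (h p - \<delta> + 3 * b) \<le> h q + 3 * b" if \<delta>: "\<delta> > 0" for \<delta>
  proof -
    obtain c w N where w: "\<And>i. \<bar>w i\<bar> \<le> N" "\<And>i. \<bar>hop d d' p w i + V i - c\<bar> \<le> \<delta> / 2"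
      using approximate_corrector[OF half_gt_zero[OF \<delta>]] by blast
    have "lambda_upper d d' r p 0 \<le> ereal (c + \<delta> / 2)"
    proof (rule lambda_upper_le_super[where w = w, OF w(1)])
      show "hop d d' p w i + V i \<le> c + \<delta> / 2" for i using w(2)[of i] by linarith
    qed
    then have hc: "h p - \<delta> \<le> c - \<delta> / 2" by (simp add: lambda_eq_h)
    have "exp (- \<bar>p - q\<bar>) * (h p - \<delta> + 3 * b) - 3 * b \<le> h q"
    proof (rule le_hI[OF w(1)])
      fix i
      have "h p - \<delta> \<le> hop d d' p w i + V i" using w(2)[of i] hc by linarith
      then have "exp (- \<bar>p - q\<bar>) * (h p - \<delta> + 3 * b) \<le> exp (- \<bar>p - q\<bar>) * (hop d d' p w i + (V i + 3 * b))"
        by (intro mult_left_mono) auto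
      also have "\<dots> \<le> hop d d' q w i + (V i + 3 * b)"
      proof -
        have "exp (p + w (i + 1) - w i) \<le> exp (\<bar>p - q\<bar> + (q + w (i + 1) - w i))"
          "exp (- p + w (i - 1) - w i) \<le> exp (\<bar>p - q\<bar> + (- q + w (i - 1) - w i))"
          by auto
        then have "hop d d' p w i \<le> d' i * exp (\<bar>p - q\<bar> + (q + w (i + 1) - w i))
            + d i * exp (\<bar>p - q\<bar> + (- q + w (i - 1) - w i))"
          unfolding hop_def using d_nonneg by (intro add_mono mult_left_mono)
        also have "\<dots> = exp \<bar>p - q\<bar> * hop d d' q w i"
          by (simp only: hop_def exp_add[of "\<bar>p - q\<bar>"] ring_distribs mult_ac)
        finally have "exp (- \<bar>p - q\<bar>) * hop d d' p w i \<le> hop d d' q w i"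
          by (simp add: exp_minus field_simps)
        moreover have "exp (- \<bar>p - q\<bar>) * (V i + 3 * b) \<le> 1 * (V i + 3 * b)"
          using V_bound[of i] by (intro mult_right_mono) auto
        ultimately show ?thesis by (simp add: distrib_left)
      qed
      finally show "exp (- \<bar>p - q\<bar>) * (h p - \<delta> + 3 * b) - 3 * b \<le> hop d d' q w i + V i" by simp
    qed
    then show ?thesis by simp
  qed
  then have *: "h p + 3 * b - \<delta> \<le> exp \<bar>p - q\<bar> * (h q + 3 * b)" if "\<delta> > 0" for \<delta>
    using that by (simp add: exp_minus field_simps)
  show ?thesis
  proof (rule field_le_epsilon)
    fix e :: real assume "e > 0"
    from *[OF this] show "h p + 3 * b \<le> exp \<bar>p - q\<bar> * (h q + 3 * b) + e" by simp
  qed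
qed

text \<open>The exponential estimate, used in both directions, says that
  \<open>ln (h p + 3 * b)\<close> is Lipschitz with constant \<open>1\<close>; the argument is
  positive by \<open>h_ge_exp\<close>.\<close>

lemma continuous_h: "continuous_on UNIV h"
proof -
  have pos: "0 < h p + 3 * b" for p
    using h_ge_exp[of p] a_pos by (smt (verit) exp_gt_zero mult_pos_pos)
  have le: "ln (h p + 3 * b) \<le> \<bar>p - q\<bar> + ln (h q + 3 * b)" for p q
  proof -
    have "ln (h p + 3 * b) \<le> ln (exp \<bar>p - q\<bar> * (h q + 3 * b))"
      using h_exp_lipschitz[of p q] pos[of p] by (rule ln_mono)
    then show ?thesis using pos[of q] by (simp add: ln_mult)
  qed
  have "1-lipschitz_on UNIV (\<lambda>p. ln (h p + 3 * b))"
  proof (rule lipschitz_onI)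
    fix p q
    show "dist (ln (h p + 3 * b)) (ln (h q + 3 * b)) \<le> 1 * dist p q"
      using le[of p q] le[of q p] by (simp add: dist_real_def abs_le_iff abs_minus_commute)
  qed simp
  then have "continuous_on UNIV (\<lambda>p. exp (ln (h p + 3 * b)) - 3 * b)"
    by (intro continuous_intros lipschitz_on_continuous_on)
  then show ?thesis using pos by simp
qed

text \<open>Outside a compact interval of positive \<open>p\<close> the quotient is at least its
  value \<open>m\<close> at \<open>1\<close>: near \<open>0\<close> because of \<open>c0\<close>,
  for large \<open>p\<close> because of the exponential growth. Continuity gives a minimum
  inside.\<close>

lemma speed_attained:
  assumes "c0 > 0" and h: "\<And>p. c0 \<le> h p"
  obtains p0 where "p0 > 0" "\<And>p. p > 0 \<Longrightarrow> h (- p0) / p0 \<le> h (- p) / p"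
proof -
  define m where "m = h (- 1)"
  have "m > 0" using h[of "-1"] \<open>c0 > 0\<close> by (simp add: m_def)
  \<comment> \<open>Below \<open>c0 / m\<close> one has \<open>c0 / p \<ge> m\<close>; above
    \<open>2 * (m + 3 * b) / a\<close> the quadratic lower bound for \<open>exp p\<close> suffices.
    Cutting off at \<open>1\<close> keeps \<open>1\<close> in the interval.\<close>
  define \<alpha> where "\<alpha> = min 1 (c0 / m)"
  define \<beta> where "\<beta> = max 1 (2 * (m + 3 * b) / a)"
  have \<alpha>: "0 < \<alpha>" "\<alpha> \<le> 1" and \<beta>: "1 \<le> \<beta>" using \<open>m > 0\<close> \<open>c0 > 0\<close> by (auto simp: \<alpha>_def \<beta>_def)
  have small: "m \<le> h (- p) / p" if "0 < p" "p < \<alpha>" for p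
  proof -
    have "p \<le> c0 / m" using that by (simp add: \<alpha>_def)
    then have "m * p \<le> c0" using \<open>m > 0\<close> by (simp add: field_simps)
    then show ?thesis using h[of "- p"] that by (simp add: pos_le_divide_eq)
  qed
  have large: "m \<le> h (- p) / p" if "p > \<beta>" for p
  proof -
    have p: "p > 1" "2 * (m + 3 * b) / a \<le> p" using that by (auto simp: \<beta>_def)
    have "p ^ 2 / 2 \<le> exp p"
      using exp_lower_Taylor_quadratic[of p] p by linarith
    then have "a * (p ^ 2 / 2) \<le> a * exp p" using a_pos by (intro mult_left_mono) auto
    moreover have "2 * (m + 3 * b) * p \<le> a * p * p"
      using p a_pos by (intro mult_right_mono) (auto simp: field_simps)
    moreover have "3 * b * 1 \<le> 3 * b * p" using p b_pos by (intro mult_left_mono) auto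
    ultimately have "m * p \<le> a * exp p - 3 * b" by (simp add: power2_eq_square algebra_simps)
    then show ?thesis using h_ge_exp[of "- p"] p by (simp add: pos_le_divide_eq)
  qed
  have "continuous_on {\<alpha>..\<beta>} (\<lambda>p. h (- p) / p)"
  proof (intro continuous_intros)
    show "continuous_on {\<alpha>..\<beta>} (\<lambda>p. h (- p))"
      by (rule continuous_on_compose2[OF continuous_h]) (auto intro: continuous_intros)
  qed (use \<alpha> in auto)
  then obtain p0 where p0: "p0 \<in> {\<alpha>..\<beta>}" "\<And>p. p \<in> {\<alpha>..\<beta>} \<Longrightarrow> h (- p0) / p0 \<le> h (- p) / p"
    using continuous_attains_inf[of "{\<alpha>..\<beta>}" "\<lambda>p. h (- p) / p"] \<alpha> \<beta> by auto
  have "h (- p0) / p0 \<le> m" using p0(2)[of 1] \<alpha> \<beta> by (simp add: m_def)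
  then have "h (- p0) / p0 \<le> h (- p) / p" if "p > 0" for p
    using that small[of p] large[of p] p0(2)[of p] by fastforce
  moreover have "p0 > 0" using p0(1) \<alpha> by simp
  ultimately show thesis using that by blast
qed

end

section \<open>Equality of the speeds\<close>

theorem theorem5p1:
  fixes d d' :: "int \<Rightarrow> real" and f :: "int \<Rightarrow> real \<Rightarrow> real" and \<gamma> :: real
  assumes d_bounds: "0 < (INF i. ereal (d i))" "(SUP i. ereal (d i)) < \<infinity>"
    and d'_bounds: "0 < (INF i. ereal (d' i))" "(SUP i. ereal (d' i)) < \<infinity>"
    and f_ends: "\<And>i. f i 0 = 0" "\<And>i. f i 1 = 0"
    and f_pos: "\<And>s. s \<in> {0<..<1} \<Longrightarrow> 0 < (INF j. ereal (f j s))"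
    and f_kpp: "\<And>i s. s \<in> {0<..<1} \<Longrightarrow> f i s \<le> growth_rate f i * s"
    and gamma: "0 < \<gamma>" "\<gamma> \<le> 1"
    and f_diff: "\<And>i. f i differentiable_on {0..1}"
    and f_holder: "(SUP i. C1_holder_norm \<gamma> (f i)) < \<infinity>"
    and liminf_pos:
      "0 < Liminf (filtercomap abs at_top) (\<lambda>i. ereal (growth_rate f i - (sqrt (d' i) - sqrt (d i))\<^sup>2))"
    and ap: "almost_periodic d'" "almost_periodic d" "almost_periodic (growth_rate f)"
  shows "omega_lower d d' (growth_rate f) \<in> speeds_lower d d' (growth_rate f) \<and>
         omega_upper d d' (growth_rate f) \<in> speeds_upper d d' (growth_rate f) \<and>
         omega_lower d d' (growth_rate f) = omega_upper d d' (growth_rate f)"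
proof -
  obtain a1 where a1: "0 < ereal a1" "ereal a1 < (INF i. ereal (d i))"
    using ereal_dense2[OF d_bounds(1)] by blast
  obtain a2 where a2: "0 < ereal a2" "ereal a2 < (INF i. ereal (d' i))"
    using ereal_dense2[OF d'_bounds(1)] by blast
  have a1': "a1 \<le> d i" and a2': "a2 \<le> d' i" for i
    using less_INF_D[OF a1(2), of i] less_INF_D[OF a2(2), of i] by auto
  obtain B1 B2 B3 where B: "\<And>i. \<bar>d i\<bar> \<le> B1" "\<And>i. \<bar>d' i\<bar> \<le> B2" "\<And>i. \<bar>growth_rate f i\<bar> \<le> B3"
    using almost_periodic_bounded ap by metis
  define a b where "a = min a1 a2" and "b = max B1 (max B2 B3)"
  interpret almost_periodic_coefficients d d' "growth_rate f" a b
  proof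
    show "0 < a" using a1(1) a2(1) by (simp add: a_def)
    fix i
    show "a \<le> d i" "a \<le> d' i" using a1'[of i] a2'[of i] by (auto simp: a_def)
    show "d i \<le> b" "d' i \<le> b" "\<bar>growth_rate f i\<bar> \<le> b" using B[of i] by (auto simp: b_def)
  qed (use ap in auto)
  obtain c0 where c0: "0 < ereal c0"
    "ereal c0 < Liminf (filtercomap abs at_top) (\<lambda>i. ereal (growth_rate f i - (sqrt (d' i) - sqrt (d i))\<^sup>2))"
    using ereal_dense2[OF liminf_pos] by blast
  have "\<forall>\<^sub>F i in filtercomap abs at_top. c0 < growth_rate f i - (sqrt (d' i) - sqrt (d i))\<^sup>2"
    using less_LiminfD[OF c0(2)] by simp
  then obtain n where n: "\<And>i. \<bar>i\<bar> \<ge> n \<Longrightarrow> c0 < growth_rate f i - (sqrt (d' i) - sqrt (d i))\<^sup>2"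
    unfolding eventually_filtercomap eventually_at_top_linorder by blast
  \<comment> \<open>With the constant test function, the arithmetic-geometric mean inequality bounds
    the neighbour terms below by \<open>2 * (sqrt (d' i) * sqrt (d i))\<close>, uniformly in
    \<open>p\<close>; what remains is the quantity in the limit inferior.\<close>
  have "c0 \<le> h p" for p
  proof (rule le_hI[where w = "\<lambda>_. 0" and N = 0])
    fix i assume "i > \<bar>n\<bar>"
    then have "c0 < growth_rate f i - (sqrt (d' i) - sqrt (d i))\<^sup>2" using n[of i] by linarith
    moreover have "(sqrt (d' i) - sqrt (d i))\<^sup>2 = d' i + d i - 2 * (sqrt (d' i) * sqrt (d i))"
      using d_nonneg by (simp add: power2_diff)
    moreover have "2 * (sqrt (d' i) * sqrt (d i)) \<le> d' i * exp p + d i * exp (- p)"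
    proof -
      have "exp (p / 2) * exp (- (p / 2)) = 1" "(exp (p / 2))\<^sup>2 = exp p" "(exp (- (p / 2)))\<^sup>2 = exp (- p)"
        by (simp_all add: power2_eq_square flip: exp_add)
      moreover have "0 \<le> (sqrt (d' i) * exp (p / 2) - sqrt (d i) * exp (- (p / 2)))\<^sup>2" by simp
      ultimately show ?thesis
        using d_nonneg by (simp add: power2_diff power_mult_distrib mult_ac)
    qed
    ultimately show "c0 \<le> hop d d' p (\<lambda>_. 0) i + V i" by (simp add: hop_def V_def)
  qed simp
  with c0(1) obtain p0 where p0: "p0 > 0" "\<And>p. p > 0 \<Longrightarrow> h (- p0) / p0 \<le> h (- p) / p"
    using speed_attained[of c0] by auto
  \<comment> \<open>Both sets of speeds are this one set, so a minimiser \<open>p0\<close> shows at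
    once that the infima are attained and coincide.\<close>
  let ?S = "{ereal (h (- p)) / ereal p | p. p > 0}"
  have S: "speeds_lower d d' (growth_rate f) = ?S" "speeds_upper d d' (growth_rate f) = ?S"
    by (simp_all add: speeds_lower_def speeds_upper_def H_eq_h)
  have mem: "ereal (h (- p0)) / ereal p0 \<in> ?S" using p0(1) by blast
  have "Inf ?S = ereal (h (- p0)) / ereal p0"
  proof (rule antisym)
    show "ereal (h (- p0)) / ereal p0 \<le> Inf ?S"
      using p0 by (intro Inf_greatest) auto
  qed (rule Inf_lower[OF mem])
  with mem show ?thesis unfolding omega_lower_def omega_upper_def S by simp
qed

end
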